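(* Let $m$ be a mass function defined on the frame $\Theta$, and let $\Upsilon\subseteq\Theta$ be an essential conflict set (of $m$ with another mass function). Let $m'$ be the function obtained from $m$ by the Full Negation Belief Transformation, defined on the extended effective frame $\Omega=\Theta^*\cup\Upsilon$. Then $m'$ is a valid mass function on $\Omega$, i.e. $m'(\emptyset)=0$ and $\sum_{A\subseteq\Omega}m'(A)=1$.
   Context: A frame $\Theta$ is a finite set of mutually exclusive and exhaustive elements. A mass function on $\Theta$ is a map $m:2^\Theta\to[0,1]$ with $m(\emptyset)=0$ and $\sum_{A\subseteq\Theta}m(A)=1$. A focal element of $m$ is a subset $A\subseteq\Theta$ with $m(A)>0$. Essential conflict set: for mass functions $m_1,m_2$ on frames $\Theta_1,\Theta_2$ with sets of focal elements $F_1,F_2$, it is the set of all $\omega\in\Theta_1\cup\Theta_2$ for which there are $i\neq j$ in $\{1,2\}$ and $A\in F_i$ with $\omega\in A$ such that $A\cap B=\emptyset$ for all $B\in F_j$. Effective frame: $\Theta^*=\{\omega\in\Theta\mid\exists A\subseteq\Theta,\ m(A)>0\text{ and }\omega\in A\}$, the union of the focal elements of $m$. Full Negation Belief Transformation: given the extended effective frame $\Omega\supseteq\Theta^*$, the mass $m(A)$ of each focal element $A$ of $m$ is transferred to the set $\Omega\setminus(\Theta^*\setminus A)$, that is, $$m'\Big(\Omega\setminus\bigcup_{\omega\in\Theta^*,\ \omega\notin A}\{\omega\}\Big)=m(A),$$ and $m'$ is $0$ on every subset of $\Omega$ not of this form for a focal element $A$. *)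

theory Defs imports Complex_Main begin

text \<open>
  A frame is a finite set \<open>\<Theta>\<close>. A mass function on it is modelled by a total function on
  \<open>'a set\<close>, of which only the values on \<open>Pow \<Theta>\<close> matter.
\<close>

definition mass_function :: "'a set \<Rightarrow> ('a set \<Rightarrow> real) \<Rightarrow> bool" where
  "mass_function \<Theta> m \<longleftrightarrow>
     finite \<Theta> \<and> (\<forall>A. A \<subseteq> \<Theta> \<longrightarrow> 0 \<le> m A \<and> m A \<le> 1) \<and> m {} = 0 \<and> (\<Sum>A\<in>Pow \<Theta>. m A) = 1"

definition focal_elements :: "'a set \<Rightarrow> ('a set \<Rightarrow> real) \<Rightarrow> 'a set set" where
  "focal_elements \<Theta> m = {A. A \<subseteq> \<Theta> \<and> m A > 0}"

definition essential_conflict_set ::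
    "'a set \<Rightarrow> ('a set \<Rightarrow> real) \<Rightarrow> 'a set \<Rightarrow> ('a set \<Rightarrow> real) \<Rightarrow> 'a set" where
  "essential_conflict_set \<Theta>1 m1 \<Theta>2 m2 =
     {\<omega> \<in> \<Theta>1 \<union> \<Theta>2.
        (\<exists>A \<in> focal_elements \<Theta>1 m1. \<omega> \<in> A \<and> (\<forall>B \<in> focal_elements \<Theta>2 m2. A \<inter> B = {})) \<or>
        (\<exists>A \<in> focal_elements \<Theta>2 m2. \<omega> \<in> A \<and> (\<forall>B \<in> focal_elements \<Theta>1 m1. A \<inter> B = {}))}"

definition effective_frame :: "'a set \<Rightarrow> ('a set \<Rightarrow> real) \<Rightarrow> 'a set" where
  "effective_frame \<Theta> m = {\<omega> \<in> \<Theta>. \<exists>A. A \<subseteq> \<Theta> \<and> m A > 0 \<and> \<omega> \<in> A}"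

definition fnbt_set :: "'a set \<Rightarrow> ('a set \<Rightarrow> real) \<Rightarrow> 'a set \<Rightarrow> 'a set \<Rightarrow> 'a set" where
  "fnbt_set \<Theta> m \<Omega> A = \<Omega> - (\<Union>\<omega>\<in>{\<omega> \<in> effective_frame \<Theta> m. \<omega> \<notin> A}. {\<omega>})"

text \<open>
  The Full Negation Belief Transformation is prescribed by the equations
  \<open>m' (fnbt_set \<Theta> m \<Omega> A) = m A\<close> for focal \<open>A\<close>, and \<open>m' B = 0\<close> for every other \<open>B\<close>.
  The description below picks the focal element from which \<open>B\<close> arises. It agrees with these
  equations when \<open>effective_frame \<Theta> m \<subseteq> \<Omega>\<close>, since \<open>fnbt_set \<Theta> m \<Omega>\<close> is then injective on the
  focal elements; for other \<open>\<Omega>\<close> the transformation is not meaningful.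
\<close>

definition fnbt :: "'a set \<Rightarrow> ('a set \<Rightarrow> real) \<Rightarrow> 'a set \<Rightarrow> 'a set \<Rightarrow> real" where
  "fnbt \<Theta> m \<Omega> B =
     (if \<exists>A \<in> focal_elements \<Theta> m. B = fnbt_set \<Theta> m \<Omega> A
      then m (THE A. A \<in> focal_elements \<Theta> m \<and> B = fnbt_set \<Theta> m \<Omega> A)
      else 0)"

end

theory Submission imports Defs begin

text \<open>
  A focal element \<open>A\<close> is contained in the effective frame \<open>\<Theta>\<^sup>*\<close>, so its image
  \<open>\<Omega> - (\<Theta>\<^sup>* - A)\<close> equals \<open>A \<union> (\<Omega> - \<Theta>\<^sup>*)\<close> and meets \<open>\<Theta>\<^sup>*\<close> exactly in \<open>A\<close>. The transformation is
  therefore injective on focal elements and takes them to nonempty sets: it merely relabels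
  the masses.
\<close>

lemma focal_elements_subset_effective_frame:
  "A \<in> focal_elements \<Theta> m \<Longrightarrow> A \<subseteq> effective_frame \<Theta> m"
  by (auto simp: focal_elements_def effective_frame_def)

lemma fnbt_set_subset: "fnbt_set \<Theta> m \<Omega> A \<subseteq> \<Omega>"
  by (auto simp: fnbt_set_def)

text \<open>Intersection with the effective frame acts as a left inverse of \<open>fnbt_set\<close>
  on focal elements; injectivity and nonemptiness of the images both rest on it.\<close>

lemma fnbt_set_Int_effective_frame:
  assumes "effective_frame \<Theta> m \<subseteq> \<Omega>" "A \<in> focal_elements \<Theta> m"
  shows "fnbt_set \<Theta> m \<Omega> A \<inter> effective_frame \<Theta> m = A"
  using assms focal_elements_subset_effective_frame[OF assms(2)]
  by (auto simp: fnbt_set_def)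

lemma inj_on_fnbt_set:
  assumes "effective_frame \<Theta> m \<subseteq> \<Omega>"
  shows "inj_on (fnbt_set \<Theta> m \<Omega>) (focal_elements \<Theta> m)"
  using fnbt_set_Int_effective_frame[OF assms] by (metis inj_onI)

text \<open>Injectivity makes the focal element behind an image unique, so the definite description
  in \<open>fnbt\<close> resolves to \<open>A\<close>.\<close>

lemma fnbt_fnbt_set:
  assumes "effective_frame \<Theta> m \<subseteq> \<Omega>" "A \<in> focal_elements \<Theta> m"
  shows "fnbt \<Theta> m \<Omega> (fnbt_set \<Theta> m \<Omega> A) = m A"
proof -
  have "(THE A'. A' \<in> focal_elements \<Theta> m \<and> fnbt_set \<Theta> m \<Omega> A = fnbt_set \<Theta> m \<Omega> A') = A"
    using assms(2) inj_onD[OF inj_on_fnbt_set[OF assms(1)]] by (intro the_equality) auto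
  then show ?thesis
    using assms(2) by (auto simp: fnbt_def)
qed

lemma fnbt_eq_0: "B \<notin> fnbt_set \<Theta> m \<Omega> ` focal_elements \<Theta> m \<Longrightarrow> fnbt \<Theta> m \<Omega> B = 0"
  by (auto simp: fnbt_def)

lemma sum_focal_elements:
  assumes "mass_function \<Theta> m"
  shows "(\<Sum>A\<in>focal_elements \<Theta> m. m A) = 1"
proof -
  have "(\<Sum>A\<in>focal_elements \<Theta> m. m A) = (\<Sum>A\<in>Pow \<Theta>. m A)"
    \<comment> \<open>Masses are nonnegative, so a subset of \<open>\<Theta>\<close> that is not
      focal has mass exactly 0.\<close>
    using assms
    by (intro sum.mono_neutral_left) (auto simp: mass_function_def focal_elements_def order.order_iff_strict)
  then show ?thesis
    using assms by (simp add: mass_function_def)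
qed

lemma mass_function_fnbt:
  assumes m: "mass_function \<Theta> m" and sub: "effective_frame \<Theta> m \<subseteq> \<Omega>" and fin: "finite \<Omega>"
  shows "mass_function \<Omega> (fnbt \<Theta> m \<Omega>)"
proof -
  let ?F = "focal_elements \<Theta> m" and ?g = "fnbt_set \<Theta> m \<Omega>"
  \<comment> \<open>Each value is either a focal mass of \<open>m\<close> or the default 0.\<close>
  have bounds: "0 \<le> fnbt \<Theta> m \<Omega> B \<and> fnbt \<Theta> m \<Omega> B \<le> 1" for B
  proof (cases "B \<in> ?g ` ?F")
    case True
    then show ?thesis
      using m fnbt_fnbt_set[OF sub] by (auto simp: mass_function_def focal_elements_def)
  qed (simp add: fnbt_eq_0)
  have "{} \<notin> ?F"
    using m by (simp add: mass_function_def focal_elements_def)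
  \<comment> \<open>An empty image would meet the effective frame in the empty set, forcing its
    focal element to be empty.\<close>
  then have "{} \<notin> ?g ` ?F"
    using fnbt_set_Int_effective_frame[OF sub] by (metis Int_empty_left imageE)
  then have empty: "fnbt \<Theta> m \<Omega> {} = 0"
    by (rule fnbt_eq_0)
  have "(\<Sum>B\<in>Pow \<Omega>. fnbt \<Theta> m \<Omega> B) = (\<Sum>B\<in>?g ` ?F. fnbt \<Theta> m \<Omega> B)"
  proof (rule sum.mono_neutral_right)
    show "?g ` ?F \<subseteq> Pow \<Omega>"
      by (auto simp only: image_subset_iff Pow_iff fnbt_set_subset)
    show "\<forall>B\<in>Pow \<Omega> - ?g ` ?F. fnbt \<Theta> m \<Omega> B = 0"
      by (simp add: fnbt_eq_0)
  qed (simp add: fin)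
  \<comment> \<open>Reindexing along the injection \<open>?g\<close> turns the sum over images back
    into one over focal elements.\<close>
  also have "\<dots> = (\<Sum>A\<in>?F. m A)"
    by (simp add: sum.reindex[OF inj_on_fnbt_set[OF sub]] fnbt_fnbt_set[OF sub])
  also have "\<dots> = 1"
    by (rule sum_focal_elements[OF m])
  finally show ?thesis
    using fin bounds empty by (simp add: mass_function_def)
qed

theorem theorem3:
  fixes \<Theta> \<Theta>\<^sub>2 \<Upsilon> \<Omega> :: "'a set" and m m\<^sub>2 :: "'a set \<Rightarrow> real"
  assumes "mass_function \<Theta> m"
    and "mass_function \<Theta>\<^sub>2 m\<^sub>2"
    and "\<Upsilon> = essential_conflict_set \<Theta> m \<Theta>\<^sub>2 m\<^sub>2"
    and "\<Upsilon> \<subseteq> \<Theta>"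
    and "\<Omega> = effective_frame \<Theta> m \<union> \<Upsilon>"
  shows "mass_function \<Omega> (fnbt \<Theta> m \<Omega>)"
proof (rule mass_function_fnbt[OF assms(1)])
  show "effective_frame \<Theta> m \<subseteq> \<Omega>"
    using assms(5) by blast
  \<comment> \<open>Finiteness of \<open>\<Omega>\<close> is inherited from the frame
    \<open>\<Theta>\<close>, which contains both parts of the union.\<close>
  have "\<Omega> \<subseteq> \<Theta>"
    using assms(4,5) by (auto simp: effective_frame_def)
  then show "finite \<Omega>"
    using assms(1) finite_subset unfolding mass_function_def by blast
qed

end
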